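(* Let $f_i(x)=\frac12 x^TP_ix-q_i^Tx+r_i$ for $x\in\mathbb{R}^n$, $i=1,\dots,m$, where $P_i$ is a symmetric $n\times n$ real matrix, $q_i\in\mathbb{R}^n$ and $r_i\in\mathbb{R}$. Suppose that $f=\sum_{i=1}^m f_i$ is strongly convex with constant $c>0$, i.e. $f(x)-\frac c2\|x\|^2$ is convex on $\mathbb{R}^n$, and let $x^*$ be the unique minimizer of $f$. Let $\{x_0^k\}_{k\ge 0}$ be the outer iterates of Random Reshuffling with stepsize $\alpha_k=R/(k+1)^s$, where $R>0$ and $s\in(0,1]$, and let $\mathrm{dist}_k=\|x_0^k-x^*\|$. Then $$\mathbb{E}(\mathrm{dist}_k)\le \frac{R\|\bar\mu\|}{c}\,\frac1{k^s}+o\Big(\frac1{k^s}\Big)\qquad\text{if } \tfrac12<s<1,$$ $$\mathbb{E}(\mathrm{dist}_k)\le \frac{R^2\|\bar\mu\|}{Rc-1}\,\frac1{k}+o\Big(\frac1{k}\Big)\qquad\text{if } s=1 \text{ and } Rc>1,$$ as $k\to\infty$, where the expectation is over the random sequence of iterates and $$\bar\mu=\frac{1}{|\Gamma|}\sum_{\sigma\in\Gamma}\mu(\sigma),\qquad \mu(\sigma)=-\sum_{1\le i<j\le m}P_{\sigma(j)}\nabla f_{\sigma(i)}(x^* ),$$ with $\Gamma$ the set of all permutations of $\{1,\dots,m\}$.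
   Context: Random Reshuffling (RR): start from a given deterministic $x_0^0\in\mathbb{R}^n$. At each cycle $k=0,1,2,\dots$ draw a permutation $\sigma_k$ of $\{1,\dots,m\}$ uniformly at random from $\Gamma$, independently over cycles, and set $x_i^k=x_{i-1}^k-\alpha_k\nabla f_{\sigma_k(i)}(x_{i-1}^k)$ for $i=1,\dots,m$; then set $x_0^{k+1}=x_m^k$. The $x_0^k$ are the outer iterates. $\|\cdot\|$ is the Euclidean norm. For deterministic sequences, $u_k\le y_k+o(z_k)$ with $z_k>0$ means that for every $\varepsilon>0$ there is $k_0$ such that $u_k\le y_k+\varepsilon z_k$ for all $k\ge k_0$. *)

theory Defs
  imports "HOL-Probability.Probability" "HOL-Combinatorics.Permutations"
begin

text \<open>Junk value where \<open>f\<close> is not differentiable at \<open>x\<close>.\<close>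

definition gradient :: "('a::real_inner \<Rightarrow> real) \<Rightarrow> 'a \<Rightarrow> 'a" where
  "gradient f x = (THE g. GDERIV f x :> g)"

definition quadratic_fun :: "real^'n^'n \<Rightarrow> real^'n \<Rightarrow> real \<Rightarrow> real^'n \<Rightarrow> real" where
  "quadratic_fun P q r x = 1/2 * (x \<bullet> (P *v x)) - q \<bullet> x + r"

definition perms :: "nat \<Rightarrow> (nat \<Rightarrow> nat) set" where
  "perms m = {\<pi>. \<pi> permutes {1..m}}"

text \<open>\<open>rr_inner f a \<pi> x i\<close> is the point reached after \<open>i\<close> inner steps of a cycle that starts at \<open>x\<close>
  and uses stepsize \<open>a\<close> and order \<open>\<pi>\<close>; \<open>rr_outer f m \<alpha> \<pi> x0 k\<close> is the point at the start of
  cycle \<open>k\<close>, where \<open>\<pi> k\<close> is the order used in cycle \<open>k\<close>.\<close>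

primrec rr_inner ::
  "(nat \<Rightarrow> 'a::real_inner \<Rightarrow> real) \<Rightarrow> real \<Rightarrow> (nat \<Rightarrow> nat) \<Rightarrow> 'a \<Rightarrow> nat \<Rightarrow> 'a" where
  "rr_inner f a \<pi> x 0 = x"
| "rr_inner f a \<pi> x (Suc i) =
     rr_inner f a \<pi> x i - a *\<^sub>R gradient (f (\<pi> (Suc i))) (rr_inner f a \<pi> x i)"

primrec rr_outer ::
  "(nat \<Rightarrow> 'a::real_inner \<Rightarrow> real) \<Rightarrow> nat \<Rightarrow> (nat \<Rightarrow> real) \<Rightarrow> (nat \<Rightarrow> nat \<Rightarrow> nat) \<Rightarrow> 'a \<Rightarrow> nat \<Rightarrow> 'a" where
  "rr_outer f m \<alpha> \<pi> x0 0 = x0"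
| "rr_outer f m \<alpha> \<pi> x0 (Suc k) = rr_inner f (\<alpha> k) (\<pi> k) (rr_outer f m \<alpha> \<pi> x0 k) m"

text \<open>Measurability into \<open>count_space (perms m)\<close>, which is part of \<open>indep_vars\<close>, makes every
  \<open>\<sigma> k \<omega>\<close> with \<open>\<omega> \<in> space M\<close> a permutation of \<open>{1..m}\<close>.\<close>

definition iid_uniform_perms :: "'w measure \<Rightarrow> nat \<Rightarrow> (nat \<Rightarrow> 'w \<Rightarrow> nat \<Rightarrow> nat) \<Rightarrow> bool" where
  "iid_uniform_perms M m \<sigma> \<longleftrightarrow>
     prob_space M \<and>
     prob_space.indep_vars M (\<lambda>_. count_space (perms m)) \<sigma> UNIV \<and>
     (\<forall>k. distr M (count_space (perms m)) (\<sigma> k) = uniform_count_measure (perms m))"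

definition rr_mu ::
  "nat \<Rightarrow> (nat \<Rightarrow> real^'n^'n) \<Rightarrow> (nat \<Rightarrow> real^'n \<Rightarrow> real) \<Rightarrow> real^'n \<Rightarrow> (nat \<Rightarrow> nat) \<Rightarrow> real^'n" where
  "rr_mu m P f xs \<pi> =
     - (\<Sum>(i, j) \<in> {(i, j). 1 \<le> i \<and> i < j \<and> j \<le> m}. P (\<pi> j) *v gradient (f (\<pi> i)) xs)"

definition rr_mu_bar ::
  "nat \<Rightarrow> (nat \<Rightarrow> real^'n^'n) \<Rightarrow> (nat \<Rightarrow> real^'n \<Rightarrow> real) \<Rightarrow> real^'n \<Rightarrow> real^'n" where
  "rr_mu_bar m P f xs = (1 / real (card (perms m))) *\<^sub>R (\<Sum>\<pi>\<in>perms m. rr_mu m P f xs \<pi>)"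

text \<open>The one-sided estimate \<open>u k \<le> y k + o(z k)\<close> as \<open>k \<rightarrow> \<infinity>\<close>, for eventually positive \<open>z\<close>.\<close>

definition le_plus_o :: "(nat \<Rightarrow> real) \<Rightarrow> (nat \<Rightarrow> real) \<Rightarrow> (nat \<Rightarrow> real) \<Rightarrow> bool" where
  "le_plus_o u y z \<longleftrightarrow> (\<forall>\<epsilon>>0. \<exists>k0. \<forall>k\<ge>k0. u k \<le> y k + \<epsilon> * z k)"

end

theory Submission
  imports Defs "HOL-Real_Asymp.Real_Asymp"
begin

text \<open>Write \<open>e\<close> for the difference between the outer iterate and \<open>x\<^sup>*\<close>, \<open>P\<close> for the sum of
  the \<open>P\<^sub>i\<close> and \<open>a\<close> for the stepsize. One cycle with order \<open>\<pi>\<close> maps \<open>e\<close> to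
  \<open>e - a P e - a\<^sup>2 \<mu>(\<pi>) + O(a\<^sup>2 \<bar>e\<bar> + a\<^sup>3)\<close>, because the terms of order \<open>a\<close> that do not involve
  \<open>e\<close> sum to the gradient at the minimizer. In the mean square, independence of the fresh order
  from \<open>e\<close> replaces \<open>\<mu>(\<pi>)\<close> in the cross term by its average, while the fluctuation of \<open>\<mu>(\<pi>)\<close>
  only enters at order \<open>a\<^sup>4\<close>. Young's inequality then gives a linear recursion for the mean square
  distance divided by \<open>a\<^sup>2\<close>, which is a contraction towards the square of the claimed constant;
  the bound on the mean distance follows by Jensen's inequality.\<close>

section \<open>Gradients of quadratics and first-order conditions\<close>

lemma gradient_eqI:
  assumes "GDERIV f x :> g"
  shows "gradient f x = g"
  unfolding gradient_def
proof (rule the_equality)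
  fix g' assume "GDERIV f x :> g'"
  then have "(\<lambda>h. inner h g') = (\<lambda>h. inner h g)"
    using assms unfolding gderiv_def by (rule has_derivative_unique)
  then have "\<And>h. inner h (g' - g) = 0"
    by (simp add: inner_diff_right fun_eq_iff)
  from this[of "g' - g"] show "g' = g" by simp
qed (fact assms)

lemma inner_symmetric_matrix:
  fixes P :: "real^'n^'n"
  assumes "transpose P = P"
  shows "x \<bullet> (P *v y) = y \<bullet> (P *v x)"
  by (metis assms dot_lmul_matrix inner_commute transpose_matrix_vector)

text \<open>By symmetry of \<open>P\<close> the two terms that the product rule yields for the
  quadratic part agree, which cancels the factor \<open>1/2\<close>.\<close>

lemma GDERIV_quadratic_fun:
  fixes P :: "real^'n^'n"
  assumes "transpose P = P"
  shows "GDERIV (quadratic_fun P q r) x :> P *v x - q"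
  unfolding gderiv_def quadratic_fun_def
  by (rule derivative_eq_intros
        bounded_linear.has_derivative[OF matrix_vector_mul_bounded_linear] refl)+
     (auto simp: fun_eq_iff inner_diff_right inner_commute inner_symmetric_matrix[OF assms, of x]
        algebra_simps)

lemma sum_gradient_at_minimizer:
  fixes P :: "nat \<Rightarrow> real^'n^'n"
  assumes "\<And>i. i \<in> I \<Longrightarrow> transpose (P i) = P i"
    and min: "is_arg_min (\<lambda>x. \<Sum>i\<in>I. quadratic_fun (P i) (q i) (r i) x) (\<lambda>_. True) xs"
  shows "(\<Sum>i\<in>I. gradient (quadratic_fun (P i) (q i) (r i)) xs) = 0"
proof -
  let ?g = "\<lambda>i. gradient (quadratic_fun (P i) (q i) (r i)) xs"
  have "((\<lambda>x. \<Sum>i\<in>I. quadratic_fun (P i) (q i) (r i) x) has_derivative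
      (\<lambda>h. \<Sum>i\<in>I. h \<bullet> ?g i)) (at xs)"
    using GDERIV_quadratic_fun[OF assms(1)]
    by (intro has_derivative_sum) (metis gderiv_def gradient_eqI)
  then have "(\<lambda>h. \<Sum>i\<in>I. h \<bullet> ?g i) = (\<lambda>h. 0)"
    using min by (intro differential_zero_maxmin[of xs UNIV]) (auto simp: is_arg_min_def not_less)
  \<comment> \<open>Testing the vanishing derivative in the direction of the gradient sum itself
    gives the squared norm of that sum.\<close>
  from fun_cong[OF this, of "\<Sum>i\<in>I. ?g i"] show ?thesis
    by (simp flip: inner_sum_right)
qed

text \<open>For a quadratic, convexity at the midpoint of \<open>h\<close> and \<open>-h\<close> already bounds the quadratic form.\<close>

lemma strongly_convex_quadratic_form:
  fixes P :: "nat \<Rightarrow> real^'n^'n"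
  assumes "convex_on UNIV (\<lambda>x. (\<Sum>i\<in>I. quadratic_fun (P i) (q i) (r i) x) - c / 2 * (norm x)\<^sup>2)"
  shows "c * (norm h)\<^sup>2 \<le> h \<bullet> (\<Sum>i\<in>I. P i *v h)"
proof -
  let ?\<phi> = "\<lambda>x. (\<Sum>i\<in>I. quadratic_fun (P i) (q i) (r i) x) - c / 2 * (norm x)\<^sup>2"
  have "?\<phi> ((1/2) *\<^sub>R h + (1/2) *\<^sub>R (-h)) \<le> 1/2 * ?\<phi> h + 1/2 * ?\<phi> (-h)"
    using convex_onD[OF assms, of "1/2" h "-h"] by simp
  \<comment> \<open>The linear terms at \<open>h\<close> and \<open>-h\<close> cancel; the constant
    terms make up the value at \<open>0\<close>, which is the midpoint.\<close>
  moreover have "(\<Sum>i\<in>I. quadratic_fun (P i) (q i) (r i) h) +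
      (\<Sum>i\<in>I. quadratic_fun (P i) (q i) (r i) (-h)) =
      h \<bullet> (\<Sum>i\<in>I. P i *v h) + 2 * (\<Sum>i\<in>I. quadratic_fun (P i) (q i) (r i) 0)"
    unfolding inner_sum_right sum_distrib_left sum.distrib[symmetric]
    by (intro sum.cong) (auto simp: quadratic_fun_def mult_minus_right
          linear_neg[OF matrix_vector_mul_linear])
  ultimately show ?thesis by (simp add: field_simps)
qed

section \<open>Asymptotics of a contractive scalar recursion\<close>

lemma filterlim_sum_at_top:
  fixes a :: "nat \<Rightarrow> real"
  assumes nonneg: "\<And>i. 0 \<le> a i" and "\<not> summable a"
  shows "filterlim (\<lambda>n. \<Sum>i<n. a i) at_top sequentially"
  unfolding filterlim_at_top
proof
  fix Z
  obtain n where "Z < (\<Sum>i<n. a i)"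
    using assms summableI_nonneg_bounded[of a Z] by (meson not_le)
  moreover have "(\<Sum>i<n. a i) \<le> (\<Sum>i<n'. a i)" if "n \<le> n'" for n'
    using that nonneg by (intro sum_mono2) auto
  ultimately show "eventually (\<lambda>n. Z \<le> (\<Sum>i<n. a i)) sequentially"
    unfolding eventually_sequentially by (meson less_imp_le order_trans)
qed

text \<open>For large \<open>k\<close> the positive part of \<open>w k - L\<close>, with a level
  \<open>L\<close> near \<open>\<gamma>0 / \<rho>0\<close>, shrinks in each step at least by the
  factor \<open>exp (- \<rho>' * a k)\<close>. Since the sum of \<open>a\<close> diverges, the
  product of these factors tends to 0, whatever the starting value.\<close>

lemma limsup_contraction_le:
  fixes w a \<rho> \<gamma> :: "nat \<Rightarrow> real"
  assumes w_nonneg: "\<And>k. 0 \<le> w k"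
    and a_pos: "\<And>k. 0 < a k"
    and a_lim: "a \<longlonglongrightarrow> 0"
    and a_sum: "\<not> summable a"
    and \<rho>_lim: "\<rho> \<longlonglongrightarrow> \<rho>0" and \<rho>0: "\<rho>0 > 0"
    and \<gamma>_lim: "\<gamma> \<longlonglongrightarrow> \<gamma>0"
    and step: "\<And>k. w (Suc k) \<le> (1 - a k * \<rho> k) * w k + a k * \<gamma> k"
    and \<epsilon>: "\<epsilon> > 0"
  shows "eventually (\<lambda>k. w k \<le> \<gamma>0 / \<rho>0 + \<epsilon>) sequentially"
proof -
  \<comment> \<open>By continuity of the quotient at \<open>\<eta> = 0\<close>, both limits can be
    perturbed at a cost below \<open>\<epsilon> / 2\<close>; the other half is reserved for the
    exponential remainder.\<close>
  have "((\<lambda>\<eta>. (\<gamma>0 + \<eta>) / (\<rho>0 - \<eta>)) \<longlongrightarrow> (\<gamma>0 + 0) / (\<rho>0 - 0)) (at_right 0)"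
    using \<rho>0 by (intro tendsto_intros) auto
  then have "eventually (\<lambda>\<eta>. (\<gamma>0 + \<eta>) / (\<rho>0 - \<eta>) < \<gamma>0 / \<rho>0 + \<epsilon> / 2) (at_right 0)"
    using \<epsilon> by (intro order_tendstoD(2)) auto
  moreover have "eventually (\<lambda>\<eta>. \<eta> \<in> {0<..<\<rho>0}) (at_right 0)"
    using \<rho>0 by (rule eventually_at_right_real)
  ultimately have "eventually (\<lambda>\<eta>. (\<gamma>0 + \<eta>) / (\<rho>0 - \<eta>) < \<gamma>0 / \<rho>0 + \<epsilon> / 2 \<and>
      \<eta> \<in> {0<..<\<rho>0}) (at_right 0)"
    by (rule eventually_conj)
  from eventually_happens'[OF _ this] obtain \<eta> where \<eta>: "0 < \<eta>" "\<eta> < \<rho>0"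
      and quot: "(\<gamma>0 + \<eta>) / (\<rho>0 - \<eta>) < \<gamma>0 / \<rho>0 + \<epsilon> / 2"
    by auto
  define \<rho>' where "\<rho>' = \<rho>0 - \<eta>"
  define L where "L = (\<gamma>0 + \<eta>) / \<rho>'"
  have \<rho>': "\<rho>' > 0" using \<eta> by (simp add: \<rho>'_def)
  have "eventually (\<lambda>k. \<rho>' < \<rho> k) sequentially"
    using \<eta> by (intro order_tendstoD(1)[OF \<rho>_lim]) (simp add: \<rho>'_def)
  moreover have "eventually (\<lambda>k. \<gamma> k < \<gamma>0 + \<eta>) sequentially"
    using \<eta> by (intro order_tendstoD(2)[OF \<gamma>_lim]) simp
  moreover have "eventually (\<lambda>k. a k < 1 / \<rho>') sequentially"
    using \<rho>' by (intro order_tendstoD(2)[OF a_lim]) simp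
  ultimately have "eventually (\<lambda>k. \<rho>' < \<rho> k \<and> \<gamma> k < \<gamma>0 + \<eta> \<and> a k < 1 / \<rho>') sequentially"
    by (intro eventually_conj)
  then obtain N where N: "\<And>k. k \<ge> N \<Longrightarrow> \<rho>' < \<rho> k \<and> \<gamma> k < \<gamma>0 + \<eta> \<and> a k < 1 / \<rho>'"
    by (auto simp: eventually_sequentially)
  have L: "\<gamma>0 + \<eta> = \<rho>' * L" using \<rho>' by (simp add: L_def)
  \<comment> \<open>Cutting off at 0 keeps the bound nonnegative, so that a factor
    \<open>1 - x\<close> in front of it may be replaced by \<open>exp (- x)\<close>.\<close>
  define z0 where "z0 = max 0 (w N - L)"
  have bound: "w (n + N) - L \<le> exp (- \<rho>' * (\<Sum>i<n. a (i + N))) * z0" for n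
  proof (induction n)
    case 0
    show ?case by (simp add: z0_def)
  next
    case (Suc n)
    let ?k = "n + N"
    have k: "\<rho>' < \<rho> ?k" "\<gamma> ?k < \<gamma>0 + \<eta>" "a ?k < 1 / \<rho>'" using N[of ?k] by auto
    have nonneg: "0 \<le> 1 - a ?k * \<rho>'" using k(3) \<rho>' by (simp add: field_simps)
    have "w (Suc ?k) \<le> (1 - a ?k * \<rho> ?k) * w ?k + a ?k * \<gamma> ?k" by (rule step)
    \<comment> \<open>Lowering \<open>\<rho> k\<close> to \<open>\<rho>'\<close> enlarges the
      right-hand side because \<open>w\<close> is nonnegative.\<close>
    also have "\<dots> \<le> (1 - a ?k * \<rho>') * w ?k + a ?k * (\<gamma>0 + \<eta>)"
      using k a_pos[of ?k] w_nonneg[of ?k]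
      by (intro add_mono mult_right_mono mult_left_mono) (auto intro: mult_left_mono)
    \<comment> \<open>\<open>L\<close> is the fixed point of the affine map, so subtracting it
      removes the forcing term.\<close>
    finally have "w (Suc ?k) - L \<le> (1 - a ?k * \<rho>') * (w ?k - L)"
      unfolding L by (simp add: algebra_simps)
    also have "\<dots> \<le> (1 - a ?k * \<rho>') * (exp (- \<rho>' * (\<Sum>i<n. a (i + N))) * z0)"
      by (rule mult_left_mono[OF Suc nonneg])
    also have "\<dots> \<le> exp (- \<rho>' * a ?k) * (exp (- \<rho>' * (\<Sum>i<n. a (i + N))) * z0)"
      using exp_ge_add_one_self[of "- \<rho>' * a ?k"]
      by (intro mult_right_mono) (auto simp: z0_def algebra_simps)
    also have "\<dots> = exp (- \<rho>' * (\<Sum>i<Suc n. a (i + N))) * z0"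
      by (simp add: algebra_simps exp_add[symmetric])
    finally show ?case by simp
  qed
  have "filterlim (\<lambda>n. \<Sum>i<n. a (i + N)) at_top sequentially"
    using a_pos a_sum by (intro filterlim_sum_at_top) (auto simp: less_imp_le)
  then have "((\<lambda>n. exp (- \<rho>' * (\<Sum>i<n. a (i + N))) * z0) \<longlonglongrightarrow> 0)"
    using \<rho>' by (intro tendsto_mult_left_zero filterlim_compose[OF exp_at_bot]
        filterlim_tendsto_neg_mult_at_bot[OF tendsto_const]) auto
  then have "eventually (\<lambda>n. exp (- \<rho>' * (\<Sum>i<n. a (i + N))) * z0 < \<epsilon> / 2) sequentially"
    using \<epsilon> by (intro order_tendstoD(2)) auto
  then have "eventually (\<lambda>n. w (n + N) \<le> \<gamma>0 / \<rho>0 + \<epsilon>) sequentially"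
  proof eventually_elim
    case (elim n)
    with bound[of n] quot show ?case by (simp add: L_def \<rho>'_def)
  qed
  then show ?thesis
    using eventually_sequentially_seg[of "\<lambda>k. w k \<le> \<gamma>0 / \<rho>0 + \<epsilon>" N] by blast
qed

section \<open>Limits and divergence of the stepsizes\<close>

lemma stepsize_ratio_limit:
  fixes R s :: real
  assumes "R > 0" "0 < s" "s < 1"
  shows "(\<lambda>k. ((R / (real k + 1) powr s)\<^sup>2 / (R / (real (Suc k) + 1) powr s)\<^sup>2 - 1)
     / (R / (real k + 1) powr s)) \<longlonglongrightarrow> 0"
  using assms by real_asymp

text \<open>The squared ratio of consecutive stepsizes is 1 plus a term of order 1/k. At exponent 1
  this is the order of the stepsize itself, so a nonzero limit survives, which later turns
  \<open>c\<close> into \<open>c - 1 / R\<close>; for a smaller exponent it is negligible.\<close>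

lemma stepsize_ratio_limit_harmonic:
  fixes R :: real
  assumes "R > 0"
  shows "(\<lambda>k. ((R / (real k + 1) powr 1)\<^sup>2 / (R / (real (Suc k) + 1) powr 1)\<^sup>2 - 1)
     / (R / (real k + 1) powr 1)) \<longlonglongrightarrow> 2 / R"
proof -
  have "((R / (real k + 1) powr 1)\<^sup>2 / (R / (real (Suc k) + 1) powr 1)\<^sup>2 - 1)
     / (R / (real k + 1) powr 1) = (2 + 1 / (real k + 1)) / R" for k
    using assms by (simp add: divide_simps) (simp add: algebra_simps power2_eq_square)
  note eq = this
  have "(\<lambda>k. (2 + 1 / (real k + 1)) / R) \<longlonglongrightarrow> 2 / R"
    using assms by (real_asymp simp: divide_inverse)
  then show ?thesis unfolding eq .
qed

lemma stepsize_tendsto_0: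
  fixes R s :: real
  assumes "0 < s"
  shows "(\<lambda>k. R / (real k + 1) powr s) \<longlonglongrightarrow> 0"
  using assms by real_asymp

lemma not_summable_stepsize:
  fixes R s :: real
  assumes "R > 0" "s \<le> 1"
  shows "\<not> summable (\<lambda>k. R / (real k + 1) powr s)"
proof
  assume "summable (\<lambda>k. R / (real k + 1) powr s)"
  then have "summable (\<lambda>k. (1 / R) * (R / (real k + 1) powr s))" by (rule summable_mult)
  then have "summable (\<lambda>k. real (Suc k) powr (-s))"
    using assms by (simp add: powr_minus divide_simps add.commute)
  then have "summable (\<lambda>k. real k powr (-s))" by (subst (asm) summable_Suc_iff)
  then show False using assms by (simp add: summable_real_powr_iff)
qed

section \<open>Expansion of one cycle around the minimizer\<close>

lemma finite_perms: "finite (perms m)"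
  by (simp add: perms_def finite_permutations)

lemma perms_in_range:
  "\<pi> \<in> perms m \<Longrightarrow> i \<in> {1..m} \<Longrightarrow> \<pi> i \<in> {1..m}"
  unfolding perms_def by (metis mem_Collect_eq permutes_in_image)

lemma sum_perms:
  "\<pi> \<in> perms m \<Longrightarrow> (\<Sum>j=1..m. h (\<pi> j)) = (\<Sum>j=1..m. h j)"
  using sum.permute[of \<pi> "{1..m}" h] by (simp add: perms_def comp_def)

text \<open>Grouping the pairs by the later position \<open>j\<close> exposes the partial gradient
  sums that the inner iteration accumulates.\<close>

lemma rr_mu_eq:
  "rr_mu m P f xs \<pi> =
    - (\<Sum>j=1..m. P (\<pi> j) *v (\<Sum>i=1..<j. gradient (f (\<pi> i)) xs))"
proof -
  have "(\<Sum>(i, j) \<in> {(i, j). 1 \<le> i \<and> i < j \<and> j \<le> m}. P (\<pi> j) *v gradient (f (\<pi> i)) xs)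
    = (\<Sum>(j, i) \<in> (SIGMA j:{1..m}. {1..<j}). P (\<pi> j) *v gradient (f (\<pi> i)) xs)"
    by (rule sum.reindex_bij_witness[of _ "\<lambda>(j, i). (i, j)" "\<lambda>(i, j). (j, i)"]) auto
  also have "\<dots> = (\<Sum>j=1..m. \<Sum>i=1..<j. P (\<pi> j) *v gradient (f (\<pi> i)) xs)"
    by (rule sum.Sigma[symmetric]) auto
  finally show ?thesis
    by (simp add: rr_mu_def linear_sum[OF matrix_vector_mul_linear])
qed

lemma finite_matrices_bound:
  fixes P :: "nat \<Rightarrow> real^'n^'n"
  assumes "finite I"
  obtains L where "L \<ge> 0" "\<And>i x. i \<in> I \<Longrightarrow> norm (P i *v x) \<le> L * norm x"
proof
  \<comment> \<open>The sum of the operator norms, unlike their maximum, also covers an empty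
    \<open>I\<close>.\<close>
  let ?L = "\<Sum>i\<in>I. onorm ((*v) (P i))"
  have nonneg: "0 \<le> onorm ((*v) (P i))" for i by (simp add: onorm_pos_le)
  then show "0 \<le> ?L" by (simp add: sum_nonneg)
  fix i x assume "i \<in> I"
  then have "onorm ((*v) (P i)) \<le> ?L"
    using assms nonneg by (intro member_le_sum) auto
  then show "norm (P i *v x) \<le> ?L * norm x"
    by (meson mult_right_mono norm_ge_zero onorm matrix_vector_mul_bounded_linear order_trans)
qed

text \<open>Second-order expansion in the stepsize \<open>a\<close>: the \<open>a\<^sup>2\<close>-term that does not depend on the
  starting point is kept explicitly, since it becomes \<^const>\<open>rr_mu\<close> after a full cycle.\<close>

lemma rr_inner_expansion:
  fixes P :: "nat \<Rightarrow> real^'n^'n"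
  assumes grad: "\<And>i x. i \<in> {1..m} \<Longrightarrow> gradient (f i) x = gradient (f i) xs + P i *v (x - xs)"
    and "i \<le> m" and A: "0 \<le> A"
  shows "\<exists>C\<ge>0. \<forall>a\<in>{0..A}. \<forall>\<pi>\<in>perms m. \<forall>x.
    norm (rr_inner f a \<pi> x i - xs
      - (x - xs - a *\<^sub>R (\<Sum>j=1..i. P (\<pi> j) *v (x - xs)) - a *\<^sub>R (\<Sum>j=1..i. gradient (f (\<pi> j)) xs)
         + a\<^sup>2 *\<^sub>R (\<Sum>j=1..i. P (\<pi> j) *v (\<Sum>l=1..<j. gradient (f (\<pi> l)) xs))))
      \<le> C * (a\<^sup>2 * norm (x - xs) + a ^ 3)"
  using \<open>i \<le> m\<close>
proof (induction i)
  case 0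
  show ?case by (intro exI[of _ 0]) auto
next
  case (Suc i)
  define S where "S = (\<lambda>(\<pi> :: nat \<Rightarrow> nat) i x. \<Sum>j=1..i. P (\<pi> j) *v (x - xs))"
  define G where "G = (\<lambda>(\<pi> :: nat \<Rightarrow> nat) i. \<Sum>j=1..i::nat. gradient (f (\<pi> j)) xs)"
  define T where "T = (\<lambda>(\<pi> :: nat \<Rightarrow> nat) i. \<Sum>j=1..i::nat. P (\<pi> j) *v (\<Sum>l=1..<j. gradient (f (\<pi> l)) xs))"
  define err where "err = (\<lambda>a \<pi> x i. rr_inner f a \<pi> x i - xs
      - (x - xs - a *\<^sub>R S \<pi> i x - a *\<^sub>R G \<pi> i + a\<^sup>2 *\<^sub>R T \<pi> i))"
  obtain C where C: "C \<ge> 0"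
    "\<And>a \<pi> x. a \<in> {0..A} \<Longrightarrow> \<pi> \<in> perms m \<Longrightarrow> norm (err a \<pi> x i) \<le> C * (a\<^sup>2 * norm (x - xs) + a ^ 3)"
    using Suc by (auto simp: err_def S_def G_def T_def)
  obtain L where L: "L \<ge> 0" "\<And>j x. j \<in> {1..m} \<Longrightarrow> norm (P j *v x) \<le> L * norm x"
    using finite_matrices_bound[of "{1..m}" P] by auto
  \<comment> \<open>There are finitely many orders, so summing over all of them gives a bound that
    is uniform in the order.\<close>
  define B where "B = (\<Sum>\<pi>\<in>perms m. norm (T \<pi> i))"
  have B: "B \<ge> 0" "\<And>\<pi>. \<pi> \<in> perms m \<Longrightarrow> norm (T \<pi> i) \<le> B"
    unfolding B_def using finite_perms by (auto intro: sum_nonneg member_le_sum)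
  \<comment> \<open>Three sources: the old error carried through one more step, \<open>S\<close> hit
    by the next matrix, and \<open>T\<close> hit by the next matrix, which is already of third order
    in \<open>a\<close>.\<close>
  define C' where "C' = (1 + A * L) * C + L * (real i * L) + L * B"
  have "norm (err a \<pi> x (Suc i)) \<le> C' * (a\<^sup>2 * norm (x - xs) + a ^ 3)"
    if a: "a \<in> {0..A}" and \<pi>: "\<pi> \<in> perms m" for a \<pi> x
  proof -
    let ?E = "err a \<pi> x i" and ?b = "a\<^sup>2 * norm (x - xs) + a ^ 3"
    let ?Q = "P (\<pi> (Suc i))"
    have idx: "\<pi> (Suc i) \<in> {1..m}" using Suc.prems by (intro perms_in_range[OF \<pi>]) auto
    have lin: "?Q *v (u + v) = ?Q *v u + ?Q *v v" "?Q *v (u - v) = ?Q *v u - ?Q *v v"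
        "?Q *v (t *\<^sub>R u) = t *\<^sub>R (?Q *v u)" for u v t
      by (simp_all add: linear_add linear_diff linear_scale)
    have y: "rr_inner f a \<pi> x i - xs =
        ?E + (x - xs - a *\<^sub>R S \<pi> i x - a *\<^sub>R G \<pi> i + a\<^sup>2 *\<^sub>R T \<pi> i)"
      by (simp add: err_def)
    have SGT: "S \<pi> (Suc i) x = S \<pi> i x + ?Q *v (x - xs)"
        "G \<pi> (Suc i) = G \<pi> i + gradient (f (\<pi> (Suc i))) xs"
        "T \<pi> (Suc i) = T \<pi> i + ?Q *v G \<pi> i"
      by (simp_all add: S_def G_def T_def atLeastLessThanSuc_atLeastAtMost)
    have "err a \<pi> x (Suc i) = (rr_inner f a \<pi> x i - xs)
        - a *\<^sub>R (gradient (f (\<pi> (Suc i))) xs + ?Q *v (rr_inner f a \<pi> x i - xs))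
        - (x - xs - a *\<^sub>R S \<pi> (Suc i) x - a *\<^sub>R G \<pi> (Suc i) + a\<^sup>2 *\<^sub>R T \<pi> (Suc i))"
      by (simp add: err_def grad[OF idx, of "rr_inner f a \<pi> x i"])
    \<comment> \<open>The increments of \<open>S\<close>, \<open>G\<close> and \<open>T\<close>
      absorb the images of \<open>x - xs\<close>, the new gradient and the image of \<open>G\<close>
      exactly; what remains is the propagated error and terms of the next order.\<close>
    also have "\<dots> = ?E - a *\<^sub>R (?Q *v ?E) + a\<^sup>2 *\<^sub>R (?Q *v S \<pi> i x) - a ^ 3 *\<^sub>R (?Q *v T \<pi> i)"
      unfolding y SGT lin
      by (simp add: algebra_simps power2_eq_square power3_eq_cube)
    also have "norm \<dots> \<le> norm ?E + a * norm (?Q *v ?E) + a\<^sup>2 * norm (?Q *v S \<pi> i x)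
        + a ^ 3 * norm (?Q *v T \<pi> i)"
      using a by (intro order_trans[OF norm_triangle_ineq4] order_trans[OF norm_triangle_ineq]
          add_mono) auto
    also have "\<dots> \<le> C * ?b + A * (L * (C * ?b)) + a\<^sup>2 * (L * (real i * L * norm (x - xs)))
        + a ^ 3 * (L * B)"
    proof (intro add_mono mult_mono)
      show "norm ?E \<le> C * ?b" by (rule C(2)[OF a \<pi>])
      show "norm (?Q *v ?E) \<le> L * (C * ?b)"
        by (rule order_trans[OF L(2)[OF idx] mult_left_mono[OF C(2)[OF a \<pi>] L(1)]])
      have "norm (S \<pi> i x) \<le> (\<Sum>j=1..i. L * norm (x - xs))"
        unfolding S_def using Suc.prems \<pi> perms_in_range[OF \<pi>]
        by (intro sum_norm_le L(2)) auto
      then show "norm (?Q *v S \<pi> i x) \<le> L * (real i * L * norm (x - xs))"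
        by (intro order_trans[OF L(2)[OF idx]] mult_left_mono L(1)) auto
      show "norm (?Q *v T \<pi> i) \<le> L * B"
        by (rule order_trans[OF L(2)[OF idx] mult_left_mono[OF B(2)[OF \<pi>] L(1)]])
    qed (use a C L B in auto)
    also have "\<dots> \<le> C' * ?b"
    proof -
      have "L * (real i * L) * (a\<^sup>2 * norm (x - xs)) \<le> L * (real i * L) * ?b"
        "L * B * a ^ 3 \<le> L * B * ?b"
        using a L B by (auto intro!: mult_left_mono)
      then show ?thesis by (simp add: C'_def algebra_simps)
    qed
    finally show ?thesis .
  qed
  moreover have "C' \<ge> 0" using A C L B by (simp add: C'_def)
  ultimately show ?case unfolding err_def S_def G_def T_def by blast
qed

text \<open>Sums over a whole cycle do not see the order: the first-order matrix term becomes the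
  full sum, and the gradients add up to zero by stationarity. Only the double sum keeps the
  permutation, and it is the negative of \<open>rr_mu\<close>.\<close>

lemma rr_cycle_expansion:
  fixes P :: "nat \<Rightarrow> real^'n^'n"
  assumes grad: "\<And>i x. i \<in> {1..m} \<Longrightarrow> gradient (f i) x = gradient (f i) xs + P i *v (x - xs)"
    and stationary: "(\<Sum>i=1..m. gradient (f i) xs) = 0" and A: "0 \<le> A"
  obtains C where "C \<ge> 0" "\<And>a \<pi> x. a \<in> {0..A} \<Longrightarrow> \<pi> \<in> perms m \<Longrightarrow>
    norm (rr_inner f a \<pi> x m - xs
      - (x - xs - a *\<^sub>R (\<Sum>j=1..m. P j *v (x - xs)) - a\<^sup>2 *\<^sub>R rr_mu m P f xs \<pi>))
      \<le> C * (a\<^sup>2 * norm (x - xs) + a ^ 3)"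
proof -
  have eq: "(\<Sum>j=1..m. P (\<pi> j) *v (x - xs)) = (\<Sum>j=1..m. P j *v (x - xs))"
    "(\<Sum>j=1..m. gradient (f (\<pi> j)) xs) = 0" if "\<pi> \<in> perms m" for \<pi> x
    using sum_perms[OF that, of "\<lambda>j. P j *v (x - xs)"]
      sum_perms[OF that, of "\<lambda>j. gradient (f j) xs"] stationary by auto
  obtain C where "C \<ge> 0" and C: "\<forall>a\<in>{0..A}. \<forall>\<pi>\<in>perms m. \<forall>x.
    norm (rr_inner f a \<pi> x m - xs
      - (x - xs - a *\<^sub>R (\<Sum>j=1..m. P (\<pi> j) *v (x - xs)) - a *\<^sub>R (\<Sum>j=1..m. gradient (f (\<pi> j)) xs)
         + a\<^sup>2 *\<^sub>R (\<Sum>j=1..m. P (\<pi> j) *v (\<Sum>l=1..<j. gradient (f (\<pi> l)) xs))))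
      \<le> C * (a\<^sup>2 * norm (x - xs) + a ^ 3)"
    using rr_inner_expansion[where f=f and P=P and xs=xs and m=m and i=m and A=A, OF grad order_refl A]
    by blast
  show ?thesis
  proof (rule that[OF \<open>C \<ge> 0\<close>])
    fix a \<pi> x assume "a \<in> {0..A}" and \<pi>: "\<pi> \<in> perms m"
    with C have "norm (rr_inner f a \<pi> x m - xs
      - (x - xs - a *\<^sub>R (\<Sum>j=1..m. P (\<pi> j) *v (x - xs)) - a *\<^sub>R (\<Sum>j=1..m. gradient (f (\<pi> j)) xs)
         + a\<^sup>2 *\<^sub>R (\<Sum>j=1..m. P (\<pi> j) *v (\<Sum>l=1..<j. gradient (f (\<pi> l)) xs))))
      \<le> C * (a\<^sup>2 * norm (x - xs) + a ^ 3)" by blast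
    then show "norm (rr_inner f a \<pi> x m - xs
      - (x - xs - a *\<^sub>R (\<Sum>j=1..m. P j *v (x - xs)) - a\<^sup>2 *\<^sub>R rr_mu m P f xs \<pi>))
      \<le> C * (a\<^sup>2 * norm (x - xs) + a ^ 3)"
      unfolding rr_mu_eq eq[OF \<pi>] by simp
  qed
qed

text \<open>The new error is a gradient step \<open>u\<close> of the full function plus a
  perturbation. Positivity of the summed matrix makes \<open>u\<close> contract; the inner product
  with \<open>rr_mu\<close> is kept exact because it is to be averaged later, and everything else
  fits into a multiple of \<open>a\<^sup>2 * (norm (x - xs))\<^sup>2 + a ^ 4\<close>.\<close>

lemma rr_cycle_norm_bound:
  fixes P :: "nat \<Rightarrow> real^'n^'n"
  assumes grad: "\<And>i x. i \<in> {1..m} \<Longrightarrow> gradient (f i) x = gradient (f i) xs + P i *v (x - xs)"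
    and stationary: "(\<Sum>i=1..m. gradient (f i) xs) = 0" and A: "0 \<le> A"
    and pos: "\<And>h. c * (norm h)\<^sup>2 \<le> h \<bullet> (\<Sum>i=1..m. P i *v h)"
  obtains C where "C \<ge> 0" "\<And>a \<pi> x. a \<in> {0..A} \<Longrightarrow> \<pi> \<in> perms m \<Longrightarrow>
    (norm (rr_inner f a \<pi> x m - xs))\<^sup>2 \<le> (1 - 2 * c * a + C * a\<^sup>2) * (norm (x - xs))\<^sup>2
      - 2 * a\<^sup>2 * ((x - xs) \<bullet> rr_mu m P f xs \<pi>) + C * a ^ 4"
proof -
  obtain C where C: "C \<ge> 0" "\<And>a \<pi> x. a \<in> {0..A} \<Longrightarrow> \<pi> \<in> perms m \<Longrightarrow>
    norm (rr_inner f a \<pi> x m - xs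
      - (x - xs - a *\<^sub>R (\<Sum>j=1..m. P j *v (x - xs)) - a\<^sup>2 *\<^sub>R rr_mu m P f xs \<pi>))
      \<le> C * (a\<^sup>2 * norm (x - xs) + a ^ 3)"
    using rr_cycle_expansion[OF grad stationary A] by blast
  obtain L0 where L0: "L0 \<ge> 0" "\<And>j x. j \<in> {1..m} \<Longrightarrow> norm (P j *v x) \<le> L0 * norm x"
    using finite_matrices_bound[of "{1..m}" P] by auto
  define L where "L = real m * L0"
  define B where "B = (\<Sum>\<pi>\<in>perms m. norm (rr_mu m P f xs \<pi>))"
  have B: "B \<ge> 0" "\<And>\<pi>. \<pi> \<in> perms m \<Longrightarrow> norm (rr_mu m P f xs \<pi>) \<le> B"
    unfolding B_def using finite_perms by (auto intro: sum_nonneg member_le_sum)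
  have "L \<ge> 0" using L0 by (simp add: L_def)
  have L: "norm (\<Sum>j=1..m. P j *v h) \<le> L * norm h" for h
    using sum_norm_le[of "{1..m}" "\<lambda>j. P j *v h" "\<lambda>_. L0 * norm h"] L0(2)
    by (simp add: L_def algebra_simps)
  \<comment> \<open>The summands are the constants of the four estimates \<open>1\<close> to
    \<open>4\<close> below, in that order; the last one contributes two.\<close>
  define K where "K = L\<^sup>2 + L * B + 3 * ((1 + A * L) * C) + 2 * (A * C)\<^sup>2 + 2 * (C * A + B)\<^sup>2"
  have K: "K \<ge> 0" using A B C \<open>L \<ge> 0\<close> by (simp add: K_def)
  show thesis
  proof (rule that[OF K])
    fix a \<pi> x assume a: "a \<in> {0..A}" and \<pi>: "\<pi> \<in> perms m"
    define e p \<mu> where "e = x - xs" and "p = (\<Sum>j=1..m. P j *v e)" and "\<mu> = rr_mu m P f xs \<pi>"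
    define u \<rho> where "u = e - a *\<^sub>R p" and "\<rho> = rr_inner f a \<pi> x m - xs - (u - a\<^sup>2 *\<^sub>R \<mu>)"
    let ?N = "norm e"
    have a0: "0 \<le> a" "a \<le> A" using a by auto
    have p: "norm p \<le> L * ?N" "c * ?N\<^sup>2 \<le> e \<bullet> p" unfolding p_def by (rule L pos)+
    have \<mu>: "norm \<mu> \<le> B" unfolding \<mu>_def by (rule B(2)[OF \<pi>])
    have \<rho>: "norm \<rho> \<le> C * (a\<^sup>2 * ?N + a ^ 3)"
      using C(2)[OF a \<pi>, of x] by (simp add: \<rho>_def u_def p_def e_def \<mu>_def)
    \<comment> \<open>The mixed third-order term is split by the arithmetic-geometric mean
      inequality.\<close>
    have cube: "2 * (a ^ 3 * ?N) \<le> a\<^sup>2 * ?N\<^sup>2 + a ^ 4"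
      using zero_le_power2[of "a * (?N - a)"]
      by (simp add: power2_eq_square power3_eq_cube power4_eq_xxxx algebra_simps)

    have "(norm u)\<^sup>2 = ?N\<^sup>2 - 2 * a * (e \<bullet> p) + a\<^sup>2 * (norm p)\<^sup>2"
      unfolding u_def power2_norm_eq_inner
      by (simp add: inner_diff_left inner_diff_right inner_commute power2_eq_square algebra_simps)
    also have "\<dots> \<le> ?N\<^sup>2 - 2 * a * (c * ?N\<^sup>2) + a\<^sup>2 * (L * ?N)\<^sup>2"
      using a0 p by (intro add_mono diff_mono mult_left_mono power_mono) auto
    finally have 1: "(norm u)\<^sup>2 \<le> ?N\<^sup>2 - 2 * a * (c * ?N\<^sup>2) + L\<^sup>2 * (a\<^sup>2 * ?N\<^sup>2)"
      by (simp add: power_mult_distrib mult_ac)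

    \<comment> \<open>Estimate \<open>2\<close> replaces \<open>u\<close> by \<open>e\<close> in the
      cross term; the discrepancy is of third order in \<open>a\<close> and is handled by
      \<open>cube\<close>.\<close>
    have "p \<bullet> \<mu> \<le> (L * ?N) * B"
      using \<open>L \<ge> 0\<close> by (intro order_trans[OF norm_cauchy_schwarz] mult_mono p \<mu>) auto
    then have "2 * a ^ 3 * (p \<bullet> \<mu>) \<le> 2 * a ^ 3 * ((L * ?N) * B)"
      using a0 by (intro mult_left_mono) auto
    also have "\<dots> \<le> L * B * (a\<^sup>2 * ?N\<^sup>2 + a ^ 4)"
      using mult_left_mono[OF cube, of "L * B"] B(1) \<open>L \<ge> 0\<close> by (simp add: mult_ac)
    finally have 2: "- 2 * a\<^sup>2 * (u \<bullet> \<mu>) \<le> - 2 * a\<^sup>2 * (e \<bullet> \<mu>) + L * B * (a\<^sup>2 * ?N\<^sup>2 + a ^ 4)"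
      by (simp add: u_def inner_diff_left power2_eq_square power3_eq_cube algebra_simps)

    have "norm u \<le> ?N + a * (L * ?N)"
      unfolding u_def using a0 p
      by (intro order_trans[OF norm_triangle_ineq4] add_mono) (auto intro: mult_left_mono)
    also have "\<dots> \<le> (1 + A * L) * ?N"
      using mult_right_mono[OF a0(2), of "L * ?N"] \<open>L \<ge> 0\<close> by (simp add: algebra_simps)
    finally have u: "norm u \<le> (1 + A * L) * ?N" .
    have "u \<bullet> \<rho> \<le> ((1 + A * L) * ?N) * (C * (a\<^sup>2 * ?N + a ^ 3))"
      using A \<open>L \<ge> 0\<close> by (intro order_trans[OF norm_cauchy_schwarz] mult_mono u \<rho>) auto
    then have "2 * (u \<bullet> \<rho>) \<le> ((1 + A * L) * C) * (2 * (a\<^sup>2 * ?N\<^sup>2) + 2 * (a ^ 3 * ?N))"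
      by (simp add: power2_eq_square algebra_simps)
    also have "\<dots> \<le> ((1 + A * L) * C) * (3 * (a\<^sup>2 * ?N\<^sup>2 + a ^ 4))"
    proof (rule mult_left_mono)
      have "2 * X + 2 * y \<le> 3 * (X + z)" if "2 * y \<le> X + z" "0 \<le> z" for X y z :: real
        using that by simp
      from this[OF cube] show "2 * (a\<^sup>2 * ?N\<^sup>2) + 2 * (a ^ 3 * ?N) \<le> 3 * (a\<^sup>2 * ?N\<^sup>2 + a ^ 4)"
        by simp
    qed (use A C(1) \<open>L \<ge> 0\<close> in auto)
    finally have 3: "2 * (u \<bullet> \<rho>) \<le> 3 * ((1 + A * L) * C) * (a\<^sup>2 * ?N\<^sup>2 + a ^ 4)"
      by (simp add: algebra_simps)

    \<comment> \<open>Here the size of the fluctuating term enters only squared, hence at fourth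
      order in \<open>a\<close>. Surplus powers of \<open>a\<close> are bounded by
      \<open>A\<close>.\<close>
    have "norm (\<rho> - a\<^sup>2 *\<^sub>R \<mu>) \<le> C * (a\<^sup>2 * ?N + a ^ 3) + a\<^sup>2 * B"
      using \<rho> \<mu> by (intro order_trans[OF norm_triangle_ineq4] add_mono) (auto intro: mult_left_mono)
    also have "\<dots> \<le> a * (A * C * ?N) + a\<^sup>2 * (C * A + B)"
    proof -
      have "a * a * (C * ?N) \<le> a * A * (C * ?N)" "a\<^sup>2 * (C * a) \<le> a\<^sup>2 * (C * A)"
        using a0 C by (auto intro!: mult_left_mono mult_right_mono)
      then show ?thesis by (simp add: power2_eq_square power3_eq_cube algebra_simps)
    qed
    finally have "(norm (\<rho> - a\<^sup>2 *\<^sub>R \<mu>))\<^sup>2 \<le> (a * (A * C * ?N) + a\<^sup>2 * (C * A + B))\<^sup>2"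
      by (rule power_mono) simp
    also have "\<dots> \<le> 2 * (a * (A * C * ?N))\<^sup>2 + 2 * (a\<^sup>2 * (C * A + B))\<^sup>2"
      using sum_squares_bound[of "a * (A * C * ?N)" "a\<^sup>2 * (C * A + B)"] by (simp add: power2_sum)
    finally have 4: "(norm (\<rho> - a\<^sup>2 *\<^sub>R \<mu>))\<^sup>2 \<le>
        2 * (A * C)\<^sup>2 * (a\<^sup>2 * ?N\<^sup>2) + 2 * (C * A + B)\<^sup>2 * a ^ 4"
      by (simp add: power_mult_distrib mult_ac flip: power_mult)

    have y: "rr_inner f a \<pi> x m - xs = u + (\<rho> - a\<^sup>2 *\<^sub>R \<mu>)" by (simp add: \<rho>_def)
    have "(norm (rr_inner f a \<pi> x m - xs))\<^sup>2 =
        (norm u)\<^sup>2 + - 2 * a\<^sup>2 * (u \<bullet> \<mu>) + 2 * (u \<bullet> \<rho>) + (norm (\<rho> - a\<^sup>2 *\<^sub>R \<mu>))\<^sup>2"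
      unfolding y power2_norm_eq_inner
      by (simp add: inner_add_left inner_add_right inner_diff_right inner_diff_left inner_commute
          algebra_simps)
    also have "\<dots> \<le> ?N\<^sup>2 - 2 * a * (c * ?N\<^sup>2) - 2 * a\<^sup>2 * (e \<bullet> \<mu>) + K * (a\<^sup>2 * ?N\<^sup>2 + a ^ 4)"
    proof -
      \<comment> \<open>Estimates \<open>1\<close> and \<open>4\<close> do not yet have the common
        form; these nonnegative terms pad them to multiples of
        \<open>a\<^sup>2 * ?N\<^sup>2 + a ^ 4\<close>.\<close>
      have "0 \<le> L\<^sup>2 * a ^ 4" "0 \<le> 2 * (A * C)\<^sup>2 * a ^ 4" "0 \<le> 2 * (C * A + B)\<^sup>2 * (a\<^sup>2 * ?N\<^sup>2)"
        using a0 by auto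
      with 1 2 3 4 show ?thesis unfolding K_def distrib_left distrib_right by linarith
    qed
    finally show "(norm (rr_inner f a \<pi> x m - xs))\<^sup>2 \<le> (1 - 2 * c * a + K * a\<^sup>2) * (norm (x - xs))\<^sup>2
      - 2 * a\<^sup>2 * ((x - xs) \<bullet> rr_mu m P f xs \<pi>) + K * a ^ 4"
      by (simp add: e_def \<mu>_def algebra_simps)
  qed
qed

section \<open>Independence of the past from the fresh permutation\<close>

lemma rr_outer_cong:
  assumes "\<And>j. j < k \<Longrightarrow> \<pi> j = \<pi>' j"
  shows "rr_outer f m \<alpha> \<pi> x0 k = rr_outer f m \<alpha> \<pi>' x0 k"
  using assms by (induction k) auto

lemma iid_uniform_perms_in_perms:
  assumes "iid_uniform_perms M m \<sigma>" "\<omega> \<in> space M"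
  shows "\<sigma> k \<omega> \<in> perms m"
proof -
  interpret prob_space M using assms by (simp add: iid_uniform_perms_def)
  have "\<sigma> k \<in> measurable M (count_space (perms m))"
    using assms by (auto simp: iid_uniform_perms_def indep_vars_def)
  then show ?thesis using assms(2) by (auto dest: measurable_space)
qed

context
  fixes M :: "'w measure" and m :: nat and \<sigma> :: "nat \<Rightarrow> 'w \<Rightarrow> nat \<Rightarrow> nat"
    and k :: nat and F :: "(nat \<Rightarrow> nat \<Rightarrow> nat) \<Rightarrow> real"
  assumes iid: "iid_uniform_perms M m \<sigma>"
    and history: "\<And>\<pi> \<pi>'. (\<And>j. j < k \<Longrightarrow> \<pi> j = \<pi>' j) \<Longrightarrow> F \<pi> = F \<pi>'"
begin

interpretation prob_space M
  using iid by (simp add: iid_uniform_perms_def)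

text \<open>This turns \<open>F\<close> into a function on a finite product space, where
  independence of disjoint index sets applies.\<close>

lemma history_restrict: "F (\<lambda>j. \<sigma> j \<omega>) = F (restrict (\<lambda>j. \<sigma> j \<omega>) {..<k})"
  by (rule history) auto

text \<open>A finite product of finite discrete spaces is discrete, so every function on it is
  measurable.\<close>

lemma measurable_on_history:
  "F \<in> borel_measurable (PiM {..<k} (\<lambda>_. count_space (perms m)))"
  by (simp add: count_space_PiM_finite countable_finite finite_perms)

lemma integrable_history: "integrable M (\<lambda>\<omega>. F (\<lambda>j. \<sigma> j \<omega>))"
proof (rule integrable_const_bound)
  let ?H = "{..<k} \<rightarrow>\<^sub>E perms m"
  have fin: "finite ?H" by (intro finite_PiE finite_perms) auto
  \<comment> \<open>Only finitely many histories exist, so the sum over all of them is a constant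
    bound.\<close>
  have "norm (F (\<lambda>j. \<sigma> j \<omega>)) \<le> (\<Sum>h\<in>?H. norm (F h))" if "\<omega> \<in> space M" for \<omega>
    unfolding history_restrict
    using fin iid_uniform_perms_in_perms[OF iid that] by (intro member_le_sum) auto
  then show "AE \<omega> in M. norm (F (\<lambda>j. \<sigma> j \<omega>)) \<le> (\<Sum>h\<in>?H. norm (F h))" by auto
  have "(\<lambda>\<omega>. restrict (\<lambda>j. \<sigma> j \<omega>) {..<k}) \<in> measurable M (PiM {..<k} (\<lambda>_. count_space (perms m)))"
    using iid by (intro measurable_restrict) (auto simp: iid_uniform_perms_def indep_vars_def)
  from measurable_compose[OF this measurable_on_history]
  show "(\<lambda>\<omega>. F (\<lambda>j. \<sigma> j \<omega>)) \<in> borel_measurable M" unfolding history_restrict .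
qed

text \<open>The history uses the indices below \<open>k\<close> and the indicator only the index
  \<open>k\<close>, so the expectation of the product factors; uniformity evaluates the second
  factor.\<close>

lemma
  assumes \<pi>: "\<pi> \<in> perms m"
  shows integral_history_indicator:
      "(\<integral>\<omega>. F (\<lambda>j. \<sigma> j \<omega>) * indicator {\<pi>} (\<sigma> k \<omega>) \<partial>M) =
        (\<integral>\<omega>. F (\<lambda>j. \<sigma> j \<omega>) \<partial>M) / card (perms m)"
    and integrable_history_indicator:
      "integrable M (\<lambda>\<omega>. F (\<lambda>j. \<sigma> j \<omega>) * indicator {\<pi>} (\<sigma> k \<omega>))"
proof -
  let ?C = "\<lambda>_::nat. count_space (perms m)"
  have meas: "\<sigma> k \<in> measurable M (count_space (perms m))"
    using iid by (auto simp: iid_uniform_perms_def indep_vars_def)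
  have indep: "indep_vars ?C \<sigma> UNIV" using iid by (simp add: iid_uniform_perms_def)
  have "indep_var borel (F \<circ> (\<lambda>\<omega>. restrict (\<lambda>j. \<sigma> j \<omega>) {..<k}))
      borel ((\<lambda>h. indicator {\<pi>} (h k)) \<circ> (\<lambda>\<omega>. restrict (\<lambda>j. \<sigma> j \<omega>) {k}))"
    by (intro indep_var_compose[OF indep_var_restrict[OF indep]] measurable_on_history)
       (auto simp: count_space_PiM_finite countable_finite finite_perms)
  then have ind: "indep_var borel (\<lambda>\<omega>. F (\<lambda>j. \<sigma> j \<omega>)) borel (\<lambda>\<omega>. indicator {\<pi>} (\<sigma> k \<omega>))"
    by (simp add: comp_def history_restrict)
  have int: "integrable M (\<lambda>\<omega>. indicator {\<pi>} (\<sigma> k \<omega>) :: real)"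
    using meas by (intro integrable_const_bound[of _ 1]) (auto simp: indicator_def)
  have "(\<integral>\<omega>. indicator {\<pi>} (\<sigma> k \<omega>) \<partial>M) =
      (\<integral>\<tau>. indicat_real {\<pi>} \<tau> \<partial>distr M (count_space (perms m)) (\<sigma> k))"
    using meas by (subst integral_distr) auto
  also have "\<dots> = (\<integral>\<tau>. indicator {\<pi>} \<tau> \<partial>uniform_count_measure (perms m))"
    using iid by (simp add: iid_uniform_perms_def)
  also have "\<dots> = measure (uniform_count_measure (perms m)) {\<pi>}"
    using \<pi> by (subst Bochner_Integration.integral_indicator)
      (auto simp: sets_uniform_count_measure space_uniform_count_measure Int_absorb2)
  also have "\<dots> = 1 / card (perms m)"
    using \<pi> by (simp add: measure_uniform_count_measure finite_perms)
  finally have prob: "(\<integral>\<omega>. indicator {\<pi>} (\<sigma> k \<omega>) \<partial>M) = 1 / card (perms m)" .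
  show "(\<integral>\<omega>. F (\<lambda>j. \<sigma> j \<omega>) * indicator {\<pi>} (\<sigma> k \<omega>) \<partial>M) =
        (\<integral>\<omega>. F (\<lambda>j. \<sigma> j \<omega>) \<partial>M) / card (perms m)"
    using indep_var_lebesgue_integral[OF ind integrable_history int] prob by simp
  show "integrable M (\<lambda>\<omega>. F (\<lambda>j. \<sigma> j \<omega>) * indicator {\<pi>} (\<sigma> k \<omega>))"
    by (rule indep_var_integrable[OF ind integrable_history int])
qed

end

text \<open>This replaces conditioning on the past: the fresh permutation is split by its finitely
  many values, each piece factors by independence, and the pieces reassemble to the average of
  \<open>\<mu>\<close>.\<close>

lemma
  fixes g :: "(nat \<Rightarrow> nat \<Rightarrow> nat) \<Rightarrow> 'a::real_inner"
  assumes iid: "iid_uniform_perms M m \<sigma>"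
    and history: "\<And>\<pi> \<pi>'. (\<And>j. j < k \<Longrightarrow> \<pi> j = \<pi>' j) \<Longrightarrow> g \<pi> = g \<pi>'"
  shows integral_inner_fresh_perm:
      "(\<integral>\<omega>. g (\<lambda>j. \<sigma> j \<omega>) \<bullet> \<mu> (\<sigma> k \<omega>) \<partial>M) =
       (\<integral>\<omega>. g (\<lambda>j. \<sigma> j \<omega>) \<bullet> ((1 / card (perms m)) *\<^sub>R (\<Sum>\<pi>\<in>perms m. \<mu> \<pi>)) \<partial>M)"
    and integrable_inner_fresh_perm:
      "integrable M (\<lambda>\<omega>. g (\<lambda>j. \<sigma> j \<omega>) \<bullet> \<mu> (\<sigma> k \<omega>))"
proof -
  have hist: "\<And>v \<pi> \<pi>'. (\<And>j. j < k \<Longrightarrow> \<pi> j = \<pi>' j) \<Longrightarrow> g \<pi> \<bullet> v = g \<pi>' \<bullet> v"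
    using history by metis
  note int = integrable_history[where F = "\<lambda>\<pi>. g \<pi> \<bullet> v" and k = k for v, OF iid hist]
    and int1 = integrable_history_indicator[where F = "\<lambda>\<pi>. g \<pi> \<bullet> v" and k = k for v, OF iid hist]
      integral_history_indicator[where F = "\<lambda>\<pi>. g \<pi> \<bullet> v" and k = k for v, OF iid hist]
  have eq: "g (\<lambda>j. \<sigma> j \<omega>) \<bullet> \<mu> (\<sigma> k \<omega>) =
      (\<Sum>\<pi>\<in>perms m. (g (\<lambda>j. \<sigma> j \<omega>) \<bullet> \<mu> \<pi>) * indicator {\<pi>} (\<sigma> k \<omega>))" if "\<omega> \<in> space M" for \<omega>
    using iid_uniform_perms_in_perms[OF iid that, of k]
    by (simp add: indicator_def finite_perms if_distrib[of "\<lambda>t. _ * t"] sum.delta' cong: if_cong)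
  show "integrable M (\<lambda>\<omega>. g (\<lambda>j. \<sigma> j \<omega>) \<bullet> \<mu> (\<sigma> k \<omega>))"
    using int1(1) by (subst Bochner_Integration.integrable_cong[OF refl eq]) (auto intro!: Bochner_Integration.integrable_sum)
  have "(\<integral>\<omega>. g (\<lambda>j. \<sigma> j \<omega>) \<bullet> \<mu> (\<sigma> k \<omega>) \<partial>M) =
      (\<integral>\<omega>. (\<Sum>\<pi>\<in>perms m. (g (\<lambda>j. \<sigma> j \<omega>) \<bullet> \<mu> \<pi>) * indicator {\<pi>} (\<sigma> k \<omega>)) \<partial>M)"
    by (intro Bochner_Integration.integral_cong refl eq)
  also have "\<dots> = (\<Sum>\<pi>\<in>perms m. (\<integral>\<omega>. g (\<lambda>j. \<sigma> j \<omega>) \<bullet> \<mu> \<pi> \<partial>M) / card (perms m))"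
    using int1 by (subst Bochner_Integration.integral_sum) (auto intro!: sum.cong)
  also have "\<dots> = (\<integral>\<omega>. (\<Sum>\<pi>\<in>perms m. g (\<lambda>j. \<sigma> j \<omega>) \<bullet> \<mu> \<pi> / card (perms m)) \<partial>M)"
    using int by (subst Bochner_Integration.integral_sum) auto
  finally show "(\<integral>\<omega>. g (\<lambda>j. \<sigma> j \<omega>) \<bullet> \<mu> (\<sigma> k \<omega>) \<partial>M) =
       (\<integral>\<omega>. g (\<lambda>j. \<sigma> j \<omega>) \<bullet> ((1 / card (perms m)) *\<^sub>R (\<Sum>\<pi>\<in>perms m. \<mu> \<pi>)) \<partial>M)"
    by (simp add: inner_sum_right sum_divide_distrib)
qed

section \<open>Recursion for the mean square distance\<close>

lemma (in prob_space) expectation_le_of_square: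
  fixes X :: "'a \<Rightarrow> real"
  assumes "integrable M X" "integrable M (\<lambda>\<omega>. (X \<omega>)\<^sup>2)" "expectation (\<lambda>\<omega>. (X \<omega>)\<^sup>2) \<le> b\<^sup>2" "0 \<le> b"
  shows "expectation X \<le> b"
proof (rule power2_le_imp_le)
  show "(expectation X)\<^sup>2 \<le> b\<^sup>2"
    \<comment> \<open>Nonnegativity of the variance is Jensen's inequality for the square.\<close>
    using variance_eq[OF assms(1,2)] variance_positive[of X] assms(3) by linarith
qed fact

text \<open>After averaging, the cross term contains only the mean \<open>rr_mu_bar\<close>. Young's
  inequality trades it for a small loss of contraction and a forcing term of third order in the
  stepsize; the weight \<open>\<theta>\<close> stays free so that the balance can be optimised
  afterwards.\<close>

lemma rr_mean_square_step:
  fixes x0 xs :: "real^'n" and P :: "nat \<Rightarrow> real^'n^'n"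
  assumes iid: "iid_uniform_perms M m \<sigma>"
    and a: "0 < \<alpha> k" and \<theta>: "0 < \<theta>"
    and cycle: "\<And>\<pi> x. \<pi> \<in> perms m \<Longrightarrow> (norm (rr_inner f (\<alpha> k) \<pi> x m - xs))\<^sup>2 \<le>
        p * (norm (x - xs))\<^sup>2 - 2 * (\<alpha> k)\<^sup>2 * ((x - xs) \<bullet> rr_mu m P f xs \<pi>) + b"
  shows "(\<integral>\<omega>. (norm (rr_outer f m \<alpha> (\<lambda>j. \<sigma> j \<omega>) x0 (Suc k) - xs))\<^sup>2 \<partial>M) \<le>
     (p + \<theta> * \<alpha> k) * (\<integral>\<omega>. (norm (rr_outer f m \<alpha> (\<lambda>j. \<sigma> j \<omega>) x0 k - xs))\<^sup>2 \<partial>M)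
       + (\<alpha> k) ^ 3 * ((norm (rr_mu_bar m P f xs))\<^sup>2 / \<theta>) + b"
proof -
  interpret prob_space M using iid by (simp add: iid_uniform_perms_def)
  define e where "e = (\<lambda>k \<pi>. rr_outer f m \<alpha> \<pi> x0 k - xs)"
  have hist: "\<And>k \<pi> \<pi>'. (\<And>j. j < k \<Longrightarrow> \<pi> j = \<pi>' j) \<Longrightarrow> e k \<pi> = e k \<pi>'"
    unfolding e_def by (metis rr_outer_cong)
  let ?e = "\<lambda>k \<omega>. e k (\<lambda>j. \<sigma> j \<omega>)" and ?\<mu> = "rr_mu m P f xs" and ?\<mu>b = "rr_mu_bar m P f xs"
  have int_sq: "integrable M (\<lambda>\<omega>. (norm (?e k \<omega>))\<^sup>2)" for k
    using hist by (intro integrable_history[OF iid, of k]) metis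
  have int_mu: "integrable M (\<lambda>\<omega>. ?e k \<omega> \<bullet> ?\<mu> (\<sigma> k \<omega>))"
    using hist by (intro integrable_inner_fresh_perm[OF iid]) metis
  have int_mub: "integrable M (\<lambda>\<omega>. ?e k \<omega> \<bullet> ?\<mu>b)"
    using hist by (intro integrable_history[OF iid, of k]) metis
  have fresh: "(\<integral>\<omega>. ?e k \<omega> \<bullet> ?\<mu> (\<sigma> k \<omega>) \<partial>M) = (\<integral>\<omega>. ?e k \<omega> \<bullet> ?\<mu>b \<partial>M)"
    unfolding rr_mu_bar_def using hist by (intro integral_inner_fresh_perm[OF iid]) metis
  have young: "- 2 * (\<alpha> k)\<^sup>2 * (v \<bullet> ?\<mu>b) \<le> \<theta> * \<alpha> k * (norm v)\<^sup>2 + (\<alpha> k) ^ 3 * ((norm ?\<mu>b)\<^sup>2 / \<theta>)" for v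
  proof -
    \<comment> \<open>The prefactor is chosen so that the mixed term of the expanded square is
      exactly the cross term.\<close>
    have "0 \<le> (\<alpha> k / \<theta>) * (norm (\<theta> *\<^sub>R v + \<alpha> k *\<^sub>R ?\<mu>b))\<^sup>2"
      using a \<theta> by simp
    also have "\<dots> = \<theta> * \<alpha> k * (norm v)\<^sup>2 + 2 * (\<alpha> k)\<^sup>2 * (v \<bullet> ?\<mu>b) + (\<alpha> k) ^ 3 * ((norm ?\<mu>b)\<^sup>2 / \<theta>)"
      using \<theta> unfolding power2_norm_eq_inner
      by (simp add: inner_add_left inner_add_right inner_commute field_simps
          power2_eq_square power3_eq_cube)
    finally show ?thesis by simp
  qed
  have "(\<integral>\<omega>. (norm (?e (Suc k) \<omega>))\<^sup>2 \<partial>M) \<le>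
      (\<integral>\<omega>. p * (norm (?e k \<omega>))\<^sup>2 - 2 * (\<alpha> k)\<^sup>2 * (?e k \<omega> \<bullet> ?\<mu> (\<sigma> k \<omega>)) + b \<partial>M)"
  proof (rule integral_mono[OF int_sq])
    show "integrable M (\<lambda>\<omega>. p * (norm (?e k \<omega>))\<^sup>2 - 2 * (\<alpha> k)\<^sup>2 * (?e k \<omega> \<bullet> ?\<mu> (\<sigma> k \<omega>)) + b)"
      using int_sq int_mu by simp
    show "(norm (?e (Suc k) \<omega>))\<^sup>2 \<le>
        p * (norm (?e k \<omega>))\<^sup>2 - 2 * (\<alpha> k)\<^sup>2 * (?e k \<omega> \<bullet> ?\<mu> (\<sigma> k \<omega>)) + b" if "\<omega> \<in> space M" for \<omega>
      using cycle[OF iid_uniform_perms_in_perms[OF iid that]] by (simp add: e_def)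
  qed
  also have "\<dots> = p * (\<integral>\<omega>. (norm (?e k \<omega>))\<^sup>2 \<partial>M) + (\<integral>\<omega>. - 2 * (\<alpha> k)\<^sup>2 * (?e k \<omega> \<bullet> ?\<mu>b) \<partial>M) + b"
    using int_sq int_mu fresh by (simp add: prob_space)
  also have "(\<integral>\<omega>. - 2 * (\<alpha> k)\<^sup>2 * (?e k \<omega> \<bullet> ?\<mu>b) \<partial>M) \<le>
      (\<integral>\<omega>. \<theta> * \<alpha> k * (norm (?e k \<omega>))\<^sup>2 + (\<alpha> k) ^ 3 * ((norm ?\<mu>b)\<^sup>2 / \<theta>) \<partial>M)"
    using int_sq int_mub by (intro integral_mono young) auto
  also have "\<dots> = \<theta> * \<alpha> k * (\<integral>\<omega>. (norm (?e k \<omega>))\<^sup>2 \<partial>M) + (\<alpha> k) ^ 3 * ((norm ?\<mu>b)\<^sup>2 / \<theta>)"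
    using int_sq by (simp add: prob_space)
  finally show ?thesis by (simp add: e_def algebra_simps)
qed

text \<open>\<open>\<delta>\<close> measures how fast the stepsizes themselves decay: rescaling the mean square distance by
  \<open>1 / (\<alpha> k)\<^sup>2\<close> costs a factor \<open>1 + 2 \<delta> \<alpha> k\<close> per cycle. Young's inequality with weight
  \<open>c - \<delta>\<close> then optimises the resulting constant.\<close>

lemma rr_mean_dist_le:
  fixes P :: "nat \<Rightarrow> real^'n^'n" and x0 xs :: "real^'n" and \<alpha> :: "nat \<Rightarrow> real"
  assumes iid: "iid_uniform_perms M m \<sigma>"
    and grad: "\<And>i x. i \<in> {1..m} \<Longrightarrow> gradient (f i) x = gradient (f i) xs + P i *v (x - xs)"
    and stationary: "(\<Sum>i=1..m. gradient (f i) xs) = 0"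
    and pos: "\<And>h. c * (norm h)\<^sup>2 \<le> h \<bullet> (\<Sum>i=1..m. P i *v h)"
    and \<alpha>_pos: "\<And>k. 0 < \<alpha> k" and \<alpha>_lim: "\<alpha> \<longlonglongrightarrow> 0" and \<alpha>_sum: "\<not> summable \<alpha>"
    and \<alpha>_ratio: "(\<lambda>k. ((\<alpha> k)\<^sup>2 / (\<alpha> (Suc k))\<^sup>2 - 1) / \<alpha> k) \<longlonglongrightarrow> 2 * \<delta>"
    and \<delta>: "\<delta> < c" and \<epsilon>: "0 < \<epsilon>"
  shows "eventually (\<lambda>k. (\<integral>\<omega>. norm (rr_outer f m \<alpha> (\<lambda>j. \<sigma> j \<omega>) x0 k - xs) \<partial>M) \<le>
    (norm (rr_mu_bar m P f xs) / (c - \<delta>) + \<epsilon>) * \<alpha> k) sequentially"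
proof -
  interpret prob_space M using iid by (simp add: iid_uniform_perms_def)
  let ?\<mu> = "norm (rr_mu_bar m P f xs)"
  define e where "e = (\<lambda>k \<pi>. rr_outer f m \<alpha> \<pi> x0 k - xs)"
  have hist: "\<And>k \<pi> \<pi>'. (\<And>j. j < k \<Longrightarrow> \<pi> j = \<pi>' j) \<Longrightarrow> e k \<pi> = e k \<pi>'"
    unfolding e_def by (metis rr_outer_cong)
  define u where "u = (\<lambda>k. \<integral>\<omega>. (norm (e k (\<lambda>j. \<sigma> j \<omega>)))\<^sup>2 \<partial>M)"
  define w where "w = (\<lambda>k. u k / (\<alpha> k)\<^sup>2)"
  define \<theta> \<gamma> t where "\<theta> = c - \<delta>" and "\<gamma> = ?\<mu>\<^sup>2 / \<theta>"
    and "t = (\<lambda>k. ((\<alpha> k)\<^sup>2 / (\<alpha> (Suc k))\<^sup>2 - 1) / \<alpha> k)"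
  have \<theta>: "0 < \<theta>" using \<delta> by (simp add: \<theta>_def)
  \<comment> \<open>A common bound on all stepsizes makes the constant \<open>C\<close> of the cycle
    estimate uniform over the cycles.\<close>
  have "Bseq \<alpha>" using \<alpha>_lim convergent_def convergent_imp_Bseq by blast
  then obtain A where A: "0 < A" "\<And>k. \<alpha> k \<le> A"
    using \<alpha>_pos unfolding Bseq_def by (metis abs_of_pos real_norm_def)
  obtain C where C: "C \<ge> 0" "\<And>a \<pi> x. a \<in> {0..A} \<Longrightarrow> \<pi> \<in> perms m \<Longrightarrow>
    (norm (rr_inner f a \<pi> x m - xs))\<^sup>2 \<le> (1 - 2 * c * a + C * a\<^sup>2) * (norm (x - xs))\<^sup>2
      - 2 * a\<^sup>2 * ((x - xs) \<bullet> rr_mu m P f xs \<pi>) + C * a ^ 4"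
    using rr_cycle_norm_bound[OF grad stationary less_imp_le[OF A(1)] pos] by blast
  \<comment> \<open>\<open>q\<close> is the factor of the mean square including the loss from
    Young's inequality. \<open>\<rho>\<close> and \<open>\<Gamma>\<close> are the rate and the
    forcing after division by the next squared stepsize, which multiplies both terms by
    \<open>1 + \<alpha> k * t k\<close>.\<close>
  define q \<rho> \<Gamma> where "q = (\<lambda>k. 1 - (2 * c - \<theta>) * \<alpha> k + C * (\<alpha> k)\<^sup>2)"
    and "\<rho> = (\<lambda>k. (2 * c - \<theta>) - C * \<alpha> k - t k * q k)"
    and "\<Gamma> = (\<lambda>k. (1 + \<alpha> k * t k) * (\<gamma> + C * \<alpha> k))"
  have u_step: "u (Suc k) \<le> q k * u k + (\<alpha> k)\<^sup>2 * (\<alpha> k * (\<gamma> + C * \<alpha> k))" for k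
  proof -
    have "u (Suc k) \<le> (1 - 2 * c * \<alpha> k + C * (\<alpha> k)\<^sup>2 + \<theta> * \<alpha> k) * u k + (\<alpha> k) ^ 3 * \<gamma> + C * (\<alpha> k) ^ 4"
      unfolding u_def e_def \<gamma>_def using \<alpha>_pos[of k] A(2)[of k]
      by (intro rr_mean_square_step[OF iid \<alpha>_pos \<theta>] C(2)) auto
    then show ?thesis
      by (simp add: q_def algebra_simps power2_eq_square power3_eq_cube power4_eq_xxxx)
  qed
  have w_step: "w (Suc k) \<le> (1 - \<alpha> k * \<rho> k) * w k + \<alpha> k * \<Gamma> k" for k
  proof -
    have ratio: "(\<alpha> k)\<^sup>2 / (\<alpha> (Suc k))\<^sup>2 = 1 + \<alpha> k * t k"
      using \<alpha>_pos[of k] by (simp add: t_def)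
    have uw: "u k = (\<alpha> k)\<^sup>2 * w k"
      using \<alpha>_pos[of k] by (simp add: w_def)
    have "w (Suc k) \<le> (q k * u k + (\<alpha> k)\<^sup>2 * (\<alpha> k * (\<gamma> + C * \<alpha> k))) / (\<alpha> (Suc k))\<^sup>2"
      unfolding w_def by (intro divide_right_mono u_step) simp
    also have "\<dots> = ((\<alpha> k)\<^sup>2 / (\<alpha> (Suc k))\<^sup>2) * (q k * w k + \<alpha> k * (\<gamma> + C * \<alpha> k))"
      unfolding uw by (simp add: algebra_simps add_divide_distrib)
    also have "\<dots> = (q k + \<alpha> k * t k * q k) * w k + \<alpha> k * \<Gamma> k"
      unfolding ratio by (simp add: \<Gamma>_def algebra_simps)
    also have "q k + \<alpha> k * t k * q k = 1 - \<alpha> k * \<rho> k"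
      by (simp add: \<rho>_def) (simp add: q_def algebra_simps power2_eq_square)
    finally show ?thesis .
  qed
  have t_lim: "t \<longlonglongrightarrow> 2 * \<delta>" using \<alpha>_ratio by (simp add: t_def)
  have "q \<longlonglongrightarrow> 1 - (2 * c - \<theta>) * 0 + C * 0\<^sup>2"
    unfolding q_def by (intro tendsto_intros \<alpha>_lim)
  \<comment> \<open>With \<open>\<theta> = c - \<delta>\<close> the limit
    \<open>2 * c - \<theta> - 2 * \<delta>\<close> is again \<open>\<theta>\<close>, so the limiting
    level \<open>\<gamma> / \<theta>\<close> is a perfect square.\<close>
  then have "\<rho> \<longlonglongrightarrow> (2 * c - \<theta>) - C * 0 - 2 * \<delta> * 1"
    unfolding \<rho>_def by (intro tendsto_intros \<alpha>_lim t_lim) simp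
  then have \<rho>_lim: "\<rho> \<longlonglongrightarrow> \<theta>" by (simp add: \<theta>_def)
  have "\<Gamma> \<longlonglongrightarrow> (1 + 0 * (2 * \<delta>)) * (\<gamma> + C * 0)"
    unfolding \<Gamma>_def by (intro tendsto_intros \<alpha>_lim t_lim)
  then have \<Gamma>_lim: "\<Gamma> \<longlonglongrightarrow> \<gamma>" by simp
  have "0 \<le> w k" for k by (simp add: w_def u_def)
  \<comment> \<open>The slack is taken as \<open>\<epsilon>\<^sup>2\<close> so that it costs at most
    \<open>\<epsilon>\<close> after the square root.\<close>
  then have "eventually (\<lambda>k. w k \<le> \<gamma> / \<theta> + \<epsilon>\<^sup>2) sequentially"
    using \<alpha>_pos \<alpha>_lim \<alpha>_sum \<rho>_lim \<theta> \<Gamma>_lim w_step \<epsilon> by (intro limsup_contraction_le) auto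
  then show ?thesis
  proof eventually_elim
    case (elim k)
    have "u k = w k * (\<alpha> k)\<^sup>2" using \<alpha>_pos[of k] by (simp add: w_def)
    also have "\<dots> \<le> (\<gamma> / \<theta> + \<epsilon>\<^sup>2) * (\<alpha> k)\<^sup>2"
      by (intro mult_right_mono elim) simp
    also have "\<gamma> / \<theta> = (?\<mu> / \<theta>)\<^sup>2" by (simp add: \<gamma>_def power2_eq_square)
    also have "(?\<mu> / \<theta>)\<^sup>2 + \<epsilon>\<^sup>2 \<le> (?\<mu> / \<theta> + \<epsilon>)\<^sup>2"
      using \<theta> \<epsilon> by (simp add: power2_sum)
    finally have "u k \<le> ((?\<mu> / \<theta> + \<epsilon>) * \<alpha> k)\<^sup>2"
      by (simp add: power_mult_distrib mult_right_mono)
    moreover have "integrable M (\<lambda>\<omega>. norm (e k (\<lambda>j. \<sigma> j \<omega>)))"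
      "integrable M (\<lambda>\<omega>. (norm (e k (\<lambda>j. \<sigma> j \<omega>)))\<^sup>2)"
      using hist by (intro integrable_history[OF iid, of k]; metis)+
    ultimately have "(\<integral>\<omega>. norm (e k (\<lambda>j. \<sigma> j \<omega>)) \<partial>M) \<le> (?\<mu> / \<theta> + \<epsilon>) * \<alpha> k"
      using \<alpha>_pos[of k] \<theta> \<epsilon> unfolding u_def by - (rule expectation_le_of_square, auto)
    then show ?case by (simp add: e_def \<theta>_def)
  qed
qed

section \<open>Passage from stepsizes to the asymptotic estimates\<close>

lemma le_plus_o_of_eventually_stepsize:
  assumes "R > 0" "s > 0" "K \<ge> 0"
    and "\<And>\<epsilon>. \<epsilon> > 0 \<Longrightarrow> eventually (\<lambda>k. u k \<le> (K + \<epsilon>) * (R / (real k + 1) powr s)) sequentially"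
  shows "le_plus_o u (\<lambda>k. R * K * (1 / real k powr s)) (\<lambda>k. 1 / real k powr s)"
  unfolding le_plus_o_def eventually_sequentially[symmetric]
proof (intro allI impI)
  fix \<epsilon> :: real assume \<epsilon>: "\<epsilon> > 0"
  with assms have "eventually (\<lambda>k. u k \<le> (K + \<epsilon> / R) * (R / (real k + 1) powr s)) sequentially"
    by simp
  \<comment> \<open>At \<open>k = 0\<close> the power is 0 and division by it yields 0, so the
    passage from \<open>real k + 1\<close> to \<open>real k\<close> below needs a positive
    \<open>k\<close>.\<close>
  with eventually_gt_at_top[of 0]
  show "eventually (\<lambda>k. u k \<le> R * K * (1 / real k powr s) + \<epsilon> * (1 / real k powr s)) sequentially"
  proof eventually_elim
    case (elim k)
    have "u k \<le> (K + \<epsilon> / R) * (R / (real k + 1) powr s)" by (rule elim)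
    also have "\<dots> \<le> (K + \<epsilon> / R) * (R / real k powr s)"
      using assms \<epsilon> elim by (intro mult_left_mono divide_left_mono powr_mono2) auto
    also have "\<dots> = R * K * (1 / real k powr s) + \<epsilon> * (1 / real k powr s)"
      using assms(1) by (simp add: add_divide_distrib algebra_simps)
    finally show ?case .
  qed
qed

theorem theorem2:
  fixes P :: "nat \<Rightarrow> real^'n^'n"
    and q :: "nat \<Rightarrow> real^'n"
    and r :: "nat \<Rightarrow> real"
    and m :: nat
    and f :: "nat \<Rightarrow> real^'n \<Rightarrow> real"
    and c R s :: real
    and x0 xs :: "real^'n"
    and \<alpha> :: "nat \<Rightarrow> real"
    and M :: "'w measure"
    and \<sigma> :: "nat \<Rightarrow> 'w \<Rightarrow> nat \<Rightarrow> nat"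
    and Edist :: "nat \<Rightarrow> real"
  assumes sym: "\<And>i. i \<in> {1..m} \<Longrightarrow> transpose (P i) = P i"
    and f_def: "f = (\<lambda>i. quadratic_fun (P i) (q i) (r i))"
    and c_pos: "c > 0"
    and strongly_convex: "convex_on UNIV (\<lambda>x. (\<Sum>i=1..m. f i x) - c / 2 * (norm x)\<^sup>2)"
    and minimizer: "is_arg_min (\<lambda>x. \<Sum>i=1..m. f i x) (\<lambda>_. True) xs"
    and R_pos: "R > 0"
    and s_range: "0 < s" "s \<le> 1"
    and \<alpha>_def: "\<alpha> = (\<lambda>k. R / (real k + 1) powr s)"
    and random: "iid_uniform_perms M m \<sigma>"
    and Edist_def: "Edist = (\<lambda>k. \<integral>\<omega>. norm (rr_outer f m \<alpha> (\<lambda>j. \<sigma> j \<omega>) x0 k - xs) \<partial>M)"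
  shows "(1/2 < s \<and> s < 1 \<longrightarrow>
           le_plus_o Edist
             (\<lambda>k. R * norm (rr_mu_bar m P f xs) / c * (1 / real k powr s))
             (\<lambda>k. 1 / real k powr s)) \<and>
         (s = 1 \<and> R * c > 1 \<longrightarrow>
           le_plus_o Edist
             (\<lambda>k. R\<^sup>2 * norm (rr_mu_bar m P f xs) / (R * c - 1) * (1 / real k))
             (\<lambda>k. 1 / real k))"
proof -
  have grad: "gradient (f i) x = P i *v x - q i" if "i \<in> {1..m}" for i x
    unfolding f_def by (intro gradient_eqI GDERIV_quadratic_fun sym that)
  have grad': "gradient (f i) x = gradient (f i) xs + P i *v (x - xs)" if "i \<in> {1..m}" for i x
    unfolding grad[OF that] by (simp add: matrix_vector_mult_diff_distrib)
  have stationary: "(\<Sum>i=1..m. gradient (f i) xs) = 0"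
    using minimizer unfolding f_def by (intro sum_gradient_at_minimizer sym) auto
  have pos: "c * (norm h)\<^sup>2 \<le> h \<bullet> (\<Sum>i=1..m. P i *v h)" for h
    using strongly_convex unfolding f_def by (rule strongly_convex_quadratic_form)
  have \<alpha>: "\<And>k. 0 < \<alpha> k" "\<alpha> \<longlonglongrightarrow> 0" "\<not> summable \<alpha>"
    unfolding \<alpha>_def using R_pos s_range
    by (auto intro: stepsize_tendsto_0 not_summable_stepsize[THEN notE] simp: add_pos_nonneg)
  \<comment> \<open>Both regimes are instances of this bound: \<open>\<delta>\<close> is 0 for
    \<open>s < 1\<close> and \<open>1 / R\<close> for \<open>s = 1\<close>.\<close>
  have bound: "le_plus_o Edist (\<lambda>k. R * (norm (rr_mu_bar m P f xs) / (c - \<delta>)) * (1 / real k powr s))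
      (\<lambda>k. 1 / real k powr s)"
    if "\<delta> < c" "(\<lambda>k. ((\<alpha> k)\<^sup>2 / (\<alpha> (Suc k))\<^sup>2 - 1) / \<alpha> k) \<longlonglongrightarrow> 2 * \<delta>" for \<delta>
    using rr_mean_dist_le[OF random grad' stationary pos \<alpha> that(2,1), of _ x0] R_pos s_range that(1)
    by (intro le_plus_o_of_eventually_stepsize) (auto simp: Edist_def \<alpha>_def)
  show ?thesis
  proof (intro conjI impI)
    assume "1/2 < s \<and> s < 1"
    then show "le_plus_o Edist (\<lambda>k. R * norm (rr_mu_bar m P f xs) / c * (1 / real k powr s))
             (\<lambda>k. 1 / real k powr s)"
      using bound[of 0] stepsize_ratio_limit[of R s] R_pos c_pos by (simp add: \<alpha>_def)
  next
    assume s: "s = 1 \<and> R * c > 1"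
    have const: "R * (norm (rr_mu_bar m P f xs) / (c - 1 / R)) =
        R\<^sup>2 * norm (rr_mu_bar m P f xs) / (R * c - 1)"
      using s R_pos by (simp add: field_simps power2_eq_square)
    \<comment> \<open>The hypothesis \<open>R * c > 1\<close> says precisely that the contraction
      rate \<open>c\<close> beats the stepsize decay \<open>\<delta> = 1 / R\<close>.\<close>
    have "1 / R < c" using s R_pos by (simp add: field_simps)
    then have "le_plus_o Edist
        (\<lambda>k. R * (norm (rr_mu_bar m P f xs) / (c - 1 / R)) * (1 / real k powr s))
        (\<lambda>k. 1 / real k powr s)"
      by (rule bound) (use s stepsize_ratio_limit_harmonic[OF R_pos] in \<open>simp add: \<alpha>_def\<close>)
    then show "le_plus_o Edist
             (\<lambda>k. R\<^sup>2 * norm (rr_mu_bar m P f xs) / (R * c - 1) * (1 / real k))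
             (\<lambda>k. 1 / real k)"
      unfolding const using s by simp
  qed
qed

end
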